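(* Let $\hat S_1=\{\bm{y}\in\mathbb{R}^d:\ y_j\in U_j\text{ for every }j\in[d]\}$. Then for every tuple $(\bm{x}_1,\dots,\bm{x}_k)$ with $\bm{x}_i\in\Xi_i$ for $i\in[k]$, $$\min_{\bm{s}\in\hat S_1}\sum_{i\in[k]}\lambda_i\|\bm{s}-\bm{x}_i\|_1=\min_{\bm{s}\in\mathbb{R}^d}\sum_{i\in[k]}\lambda_i\|\bm{s}-\bm{x}_i\|_1 .$$ Consequently, restricting the type-1 multi-marginal optimal transport formulation to $\hat S_1$ preserves the optimal barycenter value, i.e. $v_I(\hat S_1)=v_I^*$. Moreover, $|\hat S_1|\le\big(\sum_{i\in[k]}|\Xi_i|\big)^d\le(nk)^d$.
   Context: Notation: $[k]=\{1,\dots,k\}$. For $i\in[k]$, $\mathbb{P}_i=\sum_{j\in[|\Xi_i|]}\hat p_{ij}\delta_{\hat{\bm{x}}_{ij}}$ is a probability measure supported on a nonempty finite set $\Xi_i=\{\hat{\bm{x}}_{ij}\}_j\subseteq\mathbb{R}^d$ with $|\Xi_i|\le n$. Weights satisfy $\lambda_i\ge0$ and $\sum_{i\in[k]}\lambda_i=1$. The type-1 barycenter value is $v_I^*=\inf_{\mathbb{P}}\sum_{i\in[k]}\lambda_iW_1(\mathbb{P},\mathbb{P}_i)$, the infimum over Borel probability measures on $\mathbb{R}^d$ with finite first moment, where $W_1(\mathbb{P},\mathbb{Q})=\inf_{\Pi}\int\|\bm{x}-\bm{y}\|_1\,d\Pi(\bm{x},\bm{y})$ over couplings $\Pi$ of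 $\mathbb{P},\mathbb{Q}$ (note the $\ell_1$ norm). For a nonempty finite set $S\subseteq\mathbb{R}^d$, $v_I(S)$ is the minimum of $\sum_{\vec{\bm{j}}}C^{(1)}_{\vec{\bm{j}}}(S)\Pi_{\vec{\bm{j}}}$ over nonnegative tensors $\bm\Pi$ indexed by $\vec{\bm{j}}=(j_1,\dots,j_k)\in\prod_{i\in[k]}[|\Xi_i|]$ whose $i$-th marginal is $(\hat p_{ij})_j$ for every $i\in[k]$, where $C^{(1)}_{\vec{\bm{j}}}(S)=\min_{\bm{w}\in S}\sum_{i\in[k]}\lambda_i\|\bm{w}-\hat{\bm{x}}_{i,j_i}\|_1$. For $j\in[d]$, $U_j:=\{x_j:\bm{x}\in\bigcup_{i\in[k]}\Xi_i\}$ is the set of observed values of the $j$-th coordinate. *)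

theory Defs
  imports "HOL-Probability.Probability"
begin

definition l1norm :: "real ^ 'd \<Rightarrow> real" where
  "l1norm x = (\<Sum>j\<in>UNIV. \<bar>x $ j\<bar>)"

definition discrete_measure :: "nat \<Rightarrow> (nat \<Rightarrow> real) \<Rightarrow> (nat \<Rightarrow> real ^ 'd) \<Rightarrow> (real ^ 'd) measure" where
  "discrete_measure m w a =
     measure_of UNIV (sets borel) (\<lambda>A. \<Sum>j\<in>{1..m}. ennreal (w j) * emeasure (return borel (a j)) A)"

text \<open>The set function above is countably additive, so \<^const>\<open>measure_of\<close> really yields the
  weighted sum of Dirac measures (and not the null measure, its default value).\<close>

lemma sets_discrete_measure [simp]: "sets (discrete_measure m w a) = sets borel"
  unfolding discrete_measure_def using sets.sigma_sets_eq[of borel] by simp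

lemma emeasure_discrete_measure:
  fixes a :: "nat \<Rightarrow> real ^ 'd"
  assumes "A \<in> sets borel"
  shows "emeasure (discrete_measure m w a) A = (\<Sum>j\<in>{1..m}. ennreal (w j) * indicator A (a j))"
proof -
  let ?\<mu> = "\<lambda>A :: (real ^ 'd) set. \<Sum>j\<in>{1..m}. ennreal (w j) * emeasure (return borel (a j)) A"
  have "countably_additive (sets borel) ?\<mu>"
  proof (rule countably_additiveI)
    fix B :: "nat \<Rightarrow> (real ^ 'd) set"
    assume B: "range B \<subseteq> sets borel" "disjoint_family B" "(\<Union>i. B i) \<in> sets borel"
    have "(\<Sum>i. ?\<mu> (B i)) = (\<Sum>j\<in>{1..m}. \<Sum>i. ennreal (w j) * emeasure (return borel (a j)) (B i))"
      by (rule suminf_sum) simp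
    also have "\<dots> = ?\<mu> (\<Union>i. B i)"
      using B by (intro sum.cong refl) (simp add: suminf_emeasure del: emeasure_return)
    finally show "(\<Sum>i. ?\<mu> (B i)) = ?\<mu> (\<Union>i. B i)" .
  qed
  moreover have "positive (sets borel) ?\<mu>" by (simp add: positive_def)
  ultimately have "emeasure (discrete_measure m w a) A = ?\<mu> A"
    using assms sets.sigma_algebra_axioms[of borel]
    unfolding discrete_measure_def
    by (intro emeasure_measure_of_sigma) auto
  then show ?thesis using assms by simp
qed

definition couplings :: "(real ^ 'd) measure \<Rightarrow> (real ^ 'd) measure \<Rightarrow> ((real ^ 'd) \<times> (real ^ 'd)) measure set" where
  "couplings P Q = {T. prob_space T \<and> sets T = sets (borel \<Otimes>\<^sub>M borel) \<and>
     distr T borel fst = P \<and> distr T borel snd = Q}"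

definition W1 :: "(real ^ 'd) measure \<Rightarrow> (real ^ 'd) measure \<Rightarrow> ennreal" where
  "W1 P Q = (INF T \<in> couplings P Q. \<integral>\<^sup>+ (x, y). ennreal (l1norm (x - y)) \<partial>T)"

definition finite_moment_measures :: "(real ^ 'd) measure set" where
  "finite_moment_measures =
     {P. prob_space P \<and> sets P = sets borel \<and> (\<integral>\<^sup>+ x. ennreal (l1norm x) \<partial>P) < \<infinity>}"

definition barycenter_value :: "nat \<Rightarrow> (nat \<Rightarrow> real) \<Rightarrow> (nat \<Rightarrow> (real ^ 'd) measure) \<Rightarrow> ennreal" where
  "barycenter_value k lam P =
     (INF Q \<in> finite_moment_measures. \<Sum>i\<in>{1..k}. ennreal (lam i) * W1 Q (P i))"

definition weighted_cost :: "nat \<Rightarrow> (nat \<Rightarrow> real) \<Rightarrow> (nat \<Rightarrow> real ^ 'd) \<Rightarrow> real ^ 'd \<Rightarrow> real" where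
  "weighted_cost k lam x s = (\<Sum>i\<in>{1..k}. lam i * l1norm (s - x i))"

definition is_minimum :: "real \<Rightarrow> real set \<Rightarrow> bool" where
  "is_minimum v A \<longleftrightarrow> v \<in> A \<and> (\<forall>a\<in>A. v \<le> a)"

text \<open>In the multi-marginal problem, \<open>m i\<close> is the number of atoms of the \<open>i\<close>-th measure, with
  weights \<open>p i j\<close> and locations \<open>a i j\<close> for \<open>j \<in> {1..m i}\<close>.\<close>

definition multi_indices :: "nat \<Rightarrow> (nat \<Rightarrow> nat) \<Rightarrow> (nat \<Rightarrow> nat) set" where
  "multi_indices k m = (\<Pi>\<^sub>E i\<in>{1..k}. {1..m i})"

definition feasible_tensors ::
  "nat \<Rightarrow> (nat \<Rightarrow> nat) \<Rightarrow> (nat \<Rightarrow> nat \<Rightarrow> real) \<Rightarrow> ((nat \<Rightarrow> nat) \<Rightarrow> real) set" where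
  "feasible_tensors k m p = {T. (\<forall>J\<in>multi_indices k m. 0 \<le> T J) \<and>
     (\<forall>i\<in>{1..k}. \<forall>j\<in>{1..m i}. (\<Sum>J\<in>{J \<in> multi_indices k m. J i = j}. T J) = p i j)}"

definition mmot_cost ::
  "nat \<Rightarrow> (nat \<Rightarrow> real) \<Rightarrow> (nat \<Rightarrow> nat \<Rightarrow> real ^ 'd) \<Rightarrow> (real ^ 'd) set \<Rightarrow> (nat \<Rightarrow> nat) \<Rightarrow> real" where
  "mmot_cost k lam a S J = Min (weighted_cost k lam (\<lambda>i. a i (J i)) ` S)"

definition mmot_values ::
  "nat \<Rightarrow> (nat \<Rightarrow> real) \<Rightarrow> (nat \<Rightarrow> nat) \<Rightarrow> (nat \<Rightarrow> nat \<Rightarrow> real) \<Rightarrow> (nat \<Rightarrow> nat \<Rightarrow> real ^ 'd) \<Rightarrow>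
     (real ^ 'd) set \<Rightarrow> real set" where
  "mmot_values k lam m p a S =
     (\<lambda>T. \<Sum>J\<in>multi_indices k m. mmot_cost k lam a S J * T J) ` feasible_tensors k m p"

text \<open>An infimum by definition; that it is attained has to be stated separately
  (with \<^const>\<open>is_minimum\<close>).\<close>

definition mmot_value ::
  "nat \<Rightarrow> (nat \<Rightarrow> real) \<Rightarrow> (nat \<Rightarrow> nat) \<Rightarrow> (nat \<Rightarrow> nat \<Rightarrow> real) \<Rightarrow> (nat \<Rightarrow> nat \<Rightarrow> real ^ 'd) \<Rightarrow>
     (real ^ 'd) set \<Rightarrow> real" where
  "mmot_value k lam m p a S = Inf (mmot_values k lam m p a S)"

definition observed_coords :: "nat \<Rightarrow> (nat \<Rightarrow> (real ^ 'd) set) \<Rightarrow> 'd \<Rightarrow> real set" where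
  "observed_coords k Xi j = (\<lambda>x. x $ j) ` (\<Union>i\<in>{1..k}. Xi i)"

definition coord_grid :: "nat \<Rightarrow> (nat \<Rightarrow> (real ^ 'd) set) \<Rightarrow> (real ^ 'd) set" where
  "coord_grid k Xi = {y. \<forall>j. y $ j \<in> observed_coords k Xi j}"

end

theory Submission
  imports Defs
begin

text \<open>The cost of a tuple of atoms splits over the coordinates into weighted median problems, and
  each of them is piecewise affine with kinks at observed values only, so the grid contains a
  minimiser over the whole space.

  For the barycenter value, an optimal tensor pushed forward along the map from tuples to optimal
  grid points is a barycenter candidate with explicit couplings. Conversely, a candidate \<open>Q\<close> with
  nearly optimal couplings to the given measures is disintegrated over \<open>Q\<close>; drawing the \<open>k\<close> atoms
  independently given the point of \<open>Q\<close> yields a feasible tensor that costs at most as much.\<close>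

section \<open>Weighted medians\<close>

text \<open>Outside the range of \<open>U\<close>, moving \<open>t\<close> to the nearest extreme
  point shortens every distance. Between two neighbours in \<open>U\<close> the sum is affine, so
  its value at \<open>t\<close> is a weighted mean of the two end values and cannot lie below
  both.\<close>

lemma weighted_abs_sum_attained_on_points:
  fixes U :: "real set" and a lam :: "'i \<Rightarrow> real"
  assumes U: "finite U" "U \<noteq> {}" and a: "\<And>i. i \<in> I \<Longrightarrow> a i \<in> U"
    and lam: "\<And>i. i \<in> I \<Longrightarrow> 0 \<le> lam i"
  shows "\<exists>u\<in>U. (\<Sum>i\<in>I. lam i * \<bar>u - a i\<bar>) \<le> (\<Sum>i\<in>I. lam i * \<bar>t - a i\<bar>)"
proof -
  let ?f = "\<lambda>u. \<Sum>i\<in>I. lam i * \<bar>u - a i\<bar>"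
  have le: "?f u \<le> ?f t" if "\<And>i. i \<in> I \<Longrightarrow> \<bar>u - a i\<bar> \<le> \<bar>t - a i\<bar>" for u
    using that lam by (intro sum_mono mult_left_mono) auto
  consider "t \<in> U" | "t \<le> Min U" | "Max U \<le> t" | "t \<notin> U" "Min U < t" "t < Max U" by fastforce
  then show ?thesis
  proof cases
    case 1
    then show ?thesis by blast
  next
    case 2
    have "?f (Min U) \<le> ?f t"
      by (rule le) (use 2 Min_le[OF U(1) a] in fastforce)
    then show ?thesis using Min_in[OF U] by blast
  next
    case 3
    have "?f (Max U) \<le> ?f t"
      by (rule le) (use 3 Max_ge[OF U(1) a] in fastforce)
    then show ?thesis using Max_in[OF U] by blast
  next
    case 4
    \<comment> \<open>\<open>lo\<close> and \<open>hi\<close> are the neighbours of \<open>t\<close>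
      in \<open>U\<close>; both sets are nonempty since \<open>t\<close> lies strictly between
      \<open>Min U\<close> and \<open>Max U\<close>.\<close>
    define lo where "lo = Max {u \<in> U. u \<le> t}"
    define hi where "hi = Min {u \<in> U. t \<le> u}"
    have "{u \<in> U. u \<le> t} \<noteq> {}" "{u \<in> U. t \<le> u} \<noteq> {}"
      using Min_in[OF U] Max_in[OF U] 4 by (auto intro: less_imp_le)
    then have "lo \<in> {u \<in> U. u \<le> t}" "hi \<in> {u \<in> U. t \<le> u}"
      unfolding lo_def hi_def using U by (intro Max_in Min_in; simp)+
    then have lo: "lo \<in> U" "lo < t" and hi: "hi \<in> U" "t < hi"
      using 4 by (auto simp: less_le)
    \<comment> \<open>No kink lies strictly between \<open>lo\<close> and \<open>hi\<close>, so each
      distance to \<open>a i\<close> is affine there. This gives the interpolation identity below,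
      multiplied by \<open>hi - lo\<close> to avoid division.\<close>
    have gap: "u \<le> lo \<or> hi \<le> u" if "u \<in> U" for u
      unfolding lo_def hi_def using U that by (cases "u \<le> t") auto
    have "(hi - lo) * ?f t = (\<Sum>i\<in>I. lam i * ((hi - lo) * \<bar>t - a i\<bar>))"
      by (simp add: sum_distrib_left mult.left_commute)
    also have "\<dots> = (\<Sum>i\<in>I. lam i * ((hi - t) * \<bar>lo - a i\<bar> + (t - lo) * \<bar>hi - a i\<bar>))"
    proof (intro sum.cong refl)
      fix i assume "i \<in> I"
      from gap[OF a[OF this]] lo hi
      have "(hi - lo) * \<bar>t - a i\<bar> = (hi - t) * \<bar>lo - a i\<bar> + (t - lo) * \<bar>hi - a i\<bar>"
        by (auto simp: abs_if algebra_simps)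
      then show "lam i * ((hi - lo) * \<bar>t - a i\<bar>) =
          lam i * ((hi - t) * \<bar>lo - a i\<bar> + (t - lo) * \<bar>hi - a i\<bar>)" by simp
    qed
    also have "\<dots> = (hi - t) * ?f lo + (t - lo) * ?f hi"
      by (simp add: sum_distrib_left distrib_left sum.distrib mult.left_commute)
    finally have convex: "(hi - lo) * ?f t = (hi - t) * ?f lo + (t - lo) * ?f hi" .
    \<comment> \<open>The weights \<open>hi - t\<close> and \<open>t - lo\<close> are positive with
      sum \<open>hi - lo\<close>, so a mean of two values above \<open>?f t\<close> would exceed
      \<open>?f t\<close>.\<close>
    show ?thesis
    proof (rule ccontr)
      assume "\<not> ?thesis"
      then have "?f t < ?f lo" "?f t < ?f hi" using lo hi by force+
      then have "(hi - t) * ?f t + (t - lo) * ?f t < (hi - t) * ?f lo + (t - lo) * ?f hi"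
        using lo hi by (intro add_strict_mono mult_strict_left_mono) auto
      then show False using convex by (simp add: algebra_simps)
    qed
  qed
qed

text \<open>Since the l1 norm is a sum over coordinates, exchanging the two sums leaves one weighted
  median problem per coordinate, each to be solved on its own.\<close>

lemma weighted_cost_coords:
  "weighted_cost k lam x s = (\<Sum>j\<in>UNIV. \<Sum>i\<in>{1..k}. lam i * \<bar>s $ j - x i $ j\<bar>)"
  unfolding weighted_cost_def l1norm_def sum_distrib_left vector_minus_component
  by (rule sum.swap)

text \<open>The coordinate problems are independent and the grid is a full product: one observed
  value per coordinate, chosen freely, is always a grid point, whether or not it is an atom. So
  values that do at least as well as the coordinates of \<open>t\<close> can be assembled.\<close>

lemma weighted_cost_attained_on_coord_grid:
  fixes x :: "nat \<Rightarrow> real ^ 'd"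
  assumes "1 \<le> k" and "\<And>i. i \<in> {1..k} \<Longrightarrow> finite (Xi i)" and x: "\<And>i. i \<in> {1..k} \<Longrightarrow> x i \<in> Xi i"
    and "\<And>i. i \<in> {1..k} \<Longrightarrow> 0 \<le> lam i"
  shows "\<exists>s\<in>coord_grid k Xi. weighted_cost k lam x s \<le> weighted_cost k lam x t"
proof -
  have "\<exists>u\<in>observed_coords k Xi j. (\<Sum>i\<in>{1..k}. lam i * \<bar>u - x i $ j\<bar>)
      \<le> (\<Sum>i\<in>{1..k}. lam i * \<bar>t $ j - x i $ j\<bar>)" for j
  proof (rule weighted_abs_sum_attained_on_points)
    show "finite (observed_coords k Xi j)" using assms by (auto simp: observed_coords_def)
    \<comment> \<open>\<open>1 \<le> k\<close> provides the point \<open>x 1\<close>, whose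
      coordinate is an observed value.\<close>
    show "observed_coords k Xi j \<noteq> {}" using assms(1) x[of 1] by (auto simp: observed_coords_def)
  next
    fix i assume i: "i \<in> {1..k}"
    show "x i $ j \<in> observed_coords k Xi j"
      unfolding observed_coords_def using i x[OF i] by blast
  qed (use assms in auto)
  then have "\<forall>j. \<exists>u. u \<in> observed_coords k Xi j \<and>
      (\<Sum>i\<in>{1..k}. lam i * \<bar>u - x i $ j\<bar>) \<le> (\<Sum>i\<in>{1..k}. lam i * \<bar>t $ j - x i $ j\<bar>)"
    by blast
  from choice[OF this] obtain u where u: "\<And>j. u j \<in> observed_coords k Xi j"
    "\<And>j. (\<Sum>i\<in>{1..k}. lam i * \<bar>u j - x i $ j\<bar>) \<le> (\<Sum>i\<in>{1..k}. lam i * \<bar>t $ j - x i $ j\<bar>)"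
    by blast
  have "weighted_cost k lam x (\<chi> j. u j) \<le> weighted_cost k lam x t"
    unfolding weighted_cost_coords vec_lambda_beta by (intro sum_mono u(2))
  moreover have "(\<chi> j. u j) \<in> coord_grid k Xi"
    using u(1) by (simp add: coord_grid_def)
  ultimately show ?thesis by blast
qed

section \<open>Cardinality of the coordinate grid\<close>

lemma card_observed_coords_le:
  assumes "\<And>i. i \<in> {1..k} \<Longrightarrow> finite (Xi i)"
  shows "finite (observed_coords k Xi j)"
    and "card (observed_coords k Xi j) \<le> (\<Sum>i\<in>{1..k}. card (Xi i))"
proof -
  show "finite (observed_coords k Xi j)" using assms by (auto simp: observed_coords_def)
  have "card (observed_coords k Xi j) \<le> card (\<Union>i\<in>{1..k}. Xi i)"
    unfolding observed_coords_def using assms by (intro card_image_le) auto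
  also have "\<dots> \<le> (\<Sum>i\<in>{1..k}. card (Xi i))" by (intro card_UN_le) simp
  finally show "card (observed_coords k Xi j) \<le> (\<Sum>i\<in>{1..k}. card (Xi i))" .
qed

text \<open>A grid point is determined by its coordinate function, which ranges over a product of
  \<open>CARD('d)\<close> finite sets of observed values.\<close>

lemma card_coord_grid_le:
  fixes Xi :: "nat \<Rightarrow> (real ^ 'd) set"
  assumes "\<And>i. i \<in> {1..k} \<Longrightarrow> finite (Xi i)"
  shows "finite (coord_grid k Xi)"
    and "card (coord_grid k Xi) \<le> (\<Sum>i\<in>{1..k}. card (Xi i)) ^ CARD('d)"
proof -
  let ?P = "\<Pi>\<^sub>E j\<in>UNIV. observed_coords k Xi j"
  have inj: "inj_on vec_nth (coord_grid k Xi)" by (auto intro: inj_onI simp: vec_nth_inject)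
  have sub: "vec_nth ` coord_grid k Xi \<subseteq> ?P" by (auto simp: coord_grid_def)
  have fin: "finite ?P" using card_observed_coords_le(1)[OF assms] by (intro finite_PiE) auto
  show "finite (coord_grid k Xi)" using finite_imageD[OF finite_subset[OF sub fin] inj] .
  have "card (coord_grid k Xi) \<le> card ?P" using card_inj_on_le[OF inj sub fin] .
  also have "\<dots> = (\<Prod>j\<in>UNIV. card (observed_coords k Xi j))" by (simp add: card_PiE)
  also have "\<dots> \<le> (\<Prod>j\<in>(UNIV :: 'd set). (\<Sum>i\<in>{1..k}. card (Xi i)))"
    using card_observed_coords_le(2)[OF assms] by (intro prod_mono) auto
  finally show "card (coord_grid k Xi) \<le> (\<Sum>i\<in>{1..k}. card (Xi i)) ^ CARD('d)" by simp
qed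

section \<open>Tensors with given marginals\<close>

lemma finite_multi_indices: "finite (multi_indices k m)"
  unfolding multi_indices_def by (intro finite_PiE) auto

lemma multi_indices_nth: "J \<in> multi_indices k m \<Longrightarrow> i \<in> {1..k} \<Longrightarrow> J i \<in> {1..m i}"
  unfolding multi_indices_def by (rule PiE_mem)

text \<open>Grouping tuples by their \<open>i\<close>-th entry reduces a weight that reads only this
  entry to a sum against the \<open>i\<close>-th marginal. The semiring type serves both real
  tensors and \<open>ennreal\<close> integrands.\<close>

lemma sum_multi_indices_by_coordinate:
  fixes T :: "(nat \<Rightarrow> nat) \<Rightarrow> 'b :: semiring_0"
  assumes "i \<in> {1..k}"
  shows "(\<Sum>J\<in>multi_indices k m. g (J i) * T J) =
    (\<Sum>j\<in>{1..m i}. g j * (\<Sum>J\<in>{J\<in>multi_indices k m. J i = j}. T J))"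
proof -
  have "(\<lambda>J. J i) ` multi_indices k m \<subseteq> {1..m i}" using assms multi_indices_nth by fast
  from sum.group[OF finite_multi_indices finite_atLeastAtMost this, of "\<lambda>J. g (J i) * T J"]
  have "(\<Sum>J\<in>multi_indices k m. g (J i) * T J) =
      (\<Sum>j\<in>{1..m i}. \<Sum>J\<in>{J\<in>multi_indices k m. J i = j}. g (J i) * T J)" by (rule sym)
  also have "\<dots> = (\<Sum>j\<in>{1..m i}. g j * (\<Sum>J\<in>{J\<in>multi_indices k m. J i = j}. T J))"
    unfolding sum_distrib_left by (intro sum.cong refl) auto
  finally show ?thesis .
qed

text \<open>Fixing the \<open>i\<close>-th entry leaves a product index set with \<open>{j}\<close>
  as its \<open>i\<close>-th factor. The sum of products then factorises, and every other factor is
  a total mass 1. Needed for real weights and, in the gluing, for \<open>ennreal\<close> densities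
  at a point.\<close>

lemma sum_multi_indices_prod_marginal:
  fixes w :: "nat \<Rightarrow> nat \<Rightarrow> 'b :: comm_semiring_1"
  assumes i: "i \<in> {1..k}" and j: "j \<in> {1..m i}"
    and w: "\<And>i. i \<in> {1..k} \<Longrightarrow> (\<Sum>j\<in>{1..m i}. w i j) = 1"
  shows "(\<Sum>J\<in>{J\<in>multi_indices k m. J i = j}. \<Prod>i'\<in>{1..k}. w i' (J i')) = w i j"
proof -
  let ?B = "(\<lambda>i. {1..m i})(i := {j})"
  have "{J\<in>multi_indices k m. J i = j} = PiE {1..k} ?B"
    unfolding multi_indices_def using i j
    by (auto simp: PiE_iff extensional_def) (metis atLeastAtMost_iff singletonD)+
  moreover have finite_B: "finite (?B i')" for i' by simp
  ultimately have "(\<Sum>J\<in>{J\<in>multi_indices k m. J i = j}. \<Prod>i'\<in>{1..k}. w i' (J i')) =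
      (\<Prod>i'\<in>{1..k}. \<Sum>j'\<in>?B i'. w i' j')"
    by (simp only: prod_sum_PiE[OF finite_atLeastAtMost finite_B])
  also have "\<dots> = (\<Sum>j'\<in>?B i. w i j') * (\<Prod>i'\<in>{1..k} - {i}. \<Sum>j'\<in>?B i'. w i' j')"
    using i by (simp add: prod.remove)
  also have "(\<Prod>i'\<in>{1..k} - {i}. \<Sum>j'\<in>?B i'. w i' j') = 1" using w by (intro prod.neutral) auto
  also have "(\<Sum>j'\<in>?B i. w i j') * 1 = w i j" by simp
  finally show ?thesis .
qed

text \<open>The independent coupling of the marginals; it shows that the feasible set is
  nonempty.\<close>

lemma product_tensor_feasible:
  assumes "\<And>i j. i \<in> {1..k} \<Longrightarrow> j \<in> {1..m i} \<Longrightarrow> 0 \<le> p i j"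
    and "\<And>i. i \<in> {1..k} \<Longrightarrow> (\<Sum>j\<in>{1..m i}. p i j) = 1"
  shows "(\<lambda>J. \<Prod>i\<in>{1..k}. p i (J i)) \<in> feasible_tensors k m p"
  unfolding feasible_tensors_def
proof (intro CollectI conjI ballI)
  fix J assume "J \<in> multi_indices k m"
  then show "0 \<le> (\<Prod>i\<in>{1..k}. p i (J i))"
    using assms(1) multi_indices_nth by (intro prod_nonneg) blast
qed (rule sum_multi_indices_prod_marginal[OF _ _ assms(2)])

lemma sum_feasible_tensor:
  assumes "T \<in> feasible_tensors k m p" and "1 \<le> k" and "(\<Sum>j\<in>{1..m 1}. p 1 j) = 1"
  shows "(\<Sum>J\<in>multi_indices k m. T J) = 1"
  using sum_multi_indices_by_coordinate[of 1 k "\<lambda>_. 1" T m] assms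
  by (simp add: feasible_tensors_def)

text \<open>A continuous objective attains its infimum on a nonempty compact set. Finitely many
  entries of a tensor matter, and these lie in [0,1] and satisfy closed marginal
  constraints.\<close>

lemma mmot_value_attained:
  assumes "1 \<le> k" and "\<And>i j. i \<in> {1..k} \<Longrightarrow> j \<in> {1..m i} \<Longrightarrow> 0 \<le> p i j"
    and p1: "\<And>i. i \<in> {1..k} \<Longrightarrow> (\<Sum>j\<in>{1..m i}. p i j) = 1"
  shows "is_minimum (mmot_value k lam m p a S) (mmot_values k lam m p a S)"
proof -
  let ?N = "multi_indices k m"
  let ?obj = "\<lambda>T. \<Sum>J\<in>?N. mmot_cost k lam a S J * T J"
  \<comment> \<open>\<open>feasible_tensors\<close> leaves the entries off \<open>?N\<close> free
    and so is not compact. Pinning these to 0 and the others to [0,1] gives a product of compact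
    sets, compact by Tychonoff.\<close>
  define K :: "((nat \<Rightarrow> nat) \<Rightarrow> real) set" where "K = (\<Pi>\<^sub>E J\<in>UNIV. if J \<in> ?N then {0..1} else {0})"
  define M where "M = (\<Inter>i\<in>{1..k}. \<Inter>j\<in>{1..m i}.
      {T. (\<Sum>J\<in>{J \<in> ?N. J i = j}. T J) = p i j})"
  have "compactin (product_topology (\<lambda>_. euclidean) UNIV) K"
    unfolding K_def compactin_PiE by (auto simp: compactin_euclidean_iff)
  then have "compact K" by (simp add: euclidean_product_topology compactin_euclidean_iff)
  moreover have "closed M" unfolding M_def
    by (intro closed_INT ballI closed_Collect_eq continuous_intros continuous_on_product_coordinates)
  ultimately have compact: "compact (K \<inter> M)" by (rule compact_Int_closed)
  \<comment> \<open>Zeroing a feasible tensor off \<open>?N\<close> changes neither marginals nor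
    objective. The entries on \<open>?N\<close> are at most 1 because they are nonnegative with sum
    1.\<close>
  have restrict: "(\<lambda>J. if J \<in> ?N then T J else 0) \<in> K \<inter> M" if T: "T \<in> feasible_tensors k m p" for T
  proof -
    have "T J \<le> 1" if J: "J \<in> ?N" for J
    proof -
      have "T J \<le> (\<Sum>J\<in>?N. T J)"
        using T J finite_multi_indices by (intro member_le_sum) (auto simp: feasible_tensors_def)
      then show ?thesis using sum_feasible_tensor[OF T] assms by simp
    qed
    then show ?thesis using T by (auto simp: K_def M_def feasible_tensors_def)
  qed
  moreover have feasible: "K \<inter> M \<subseteq> feasible_tensors k m p"
  proof
    fix T assume T: "T \<in> K \<inter> M"
    have "0 \<le> T J" if "J \<in> ?N" for J
    proof -
      have "T J \<in> (if J \<in> ?N then {0..1} else {0})" using T unfolding K_def by blast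
      then show ?thesis using that by simp
    qed
    then show "T \<in> feasible_tensors k m p" using T unfolding M_def feasible_tensors_def by blast
  qed
  moreover have "K \<inter> M \<noteq> {}" using restrict[OF product_tensor_feasible] assms by blast
  moreover have "continuous_on (K \<inter> M) ?obj"
    by (intro continuous_intros continuous_on_subset[OF continuous_on_product_coordinates]) simp
  ultimately have "\<exists>T\<in>K \<inter> M. \<forall>T'\<in>K \<inter> M. ?obj T \<le> ?obj T'"
    by (intro continuous_attains_inf[OF compact])
  then obtain T where T: "T \<in> K \<inter> M" "\<And>T'. T' \<in> K \<inter> M \<Longrightarrow> ?obj T \<le> ?obj T'"
    by (elim bexE) (rule that, assumption, drule bspec)
  have min: "?obj T \<le> v" if "v \<in> mmot_values k lam m p a S" for v
  proof -
    obtain T' where T': "T' \<in> feasible_tensors k m p" "v = ?obj T'"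
      using \<open>v \<in> mmot_values k lam m p a S\<close> by (auto simp: mmot_values_def)
    have "?obj T \<le> ?obj (\<lambda>J. if J \<in> ?N then T' J else 0)" using T(2) restrict[OF T'(1)] .
    then show ?thesis using T' by (simp cong: sum.cong)
  qed
  have "?obj T \<in> mmot_values k lam m p a S" using T(1) feasible by (auto simp: mmot_values_def)
  moreover from this have "mmot_value k lam m p a S = ?obj T"
    unfolding mmot_value_def using min by (intro cInf_eq_minimum) auto
  ultimately show ?thesis using min by (simp add: is_minimum_def)
qed

section \<open>From tensors to couplings\<close>

lemma l1norm_nonneg: "0 \<le> l1norm x"
  by (simp add: l1norm_def sum_nonneg)

lemma borel_measurable_l1norm [measurable]: "l1norm \<in> borel_measurable borel"
  unfolding l1norm_def by (intro borel_measurable_continuous_onI continuous_intros)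

lemma weighted_cost_nonneg: "(\<And>i. i \<in> {1..k} \<Longrightarrow> 0 \<le> lam i) \<Longrightarrow> 0 \<le> weighted_cost k lam x s"
  unfolding weighted_cost_def by (intro sum_nonneg mult_nonneg_nonneg l1norm_nonneg) auto

lemma ennreal_weighted_cost:
  assumes "\<And>i. i \<in> {1..k} \<Longrightarrow> 0 \<le> lam i"
  shows "ennreal (weighted_cost k lam x s) = (\<Sum>i\<in>{1..k}. ennreal (lam i) * ennreal (l1norm (s - x i)))"
proof -
  have "ennreal (weighted_cost k lam x s) = (\<Sum>i\<in>{1..k}. ennreal (lam i * l1norm (s - x i)))"
    unfolding weighted_cost_def
    by (rule sum_ennreal[symmetric]) (intro mult_nonneg_nonneg assms l1norm_nonneg)
  also have "\<dots> = (\<Sum>i\<in>{1..k}. ennreal (lam i) * ennreal (l1norm (s - x i)))"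
    by (intro sum.cong refl ennreal_mult assms l1norm_nonneg)
  finally show ?thesis .
qed

text \<open>A tensor is read as a point measure on tuples. A function of the entry
  \<open>J i\<close> alone sees only the \<open>i\<close>-th marginal, so integrating the indicator
  of a Borel set gives the mass of the discrete measure.\<close>

lemma distr_point_measure_eq_discrete_measure:
  fixes a :: "nat \<Rightarrow> real ^ 'd"
  assumes T: "T \<in> feasible_tensors k m p" and i: "i \<in> {1..k}"
  shows "distr (point_measure (multi_indices k m) (\<lambda>J. ennreal (T J))) borel (\<lambda>J. a (J i)) =
    discrete_measure (m i) (p i) a"
proof (rule measure_eqI)
  let ?N = "multi_indices k m"
  let ?M = "point_measure ?N (\<lambda>J. ennreal (T J))"
  fix A assume "A \<in> sets (distr ?M borel (\<lambda>J. a (J i)))"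
  then have A: "A \<in> sets borel" by simp
  have "emeasure (distr ?M borel (\<lambda>J. a (J i))) A = (\<integral>\<^sup>+x. indicator A x \<partial>distr ?M borel (\<lambda>J. a (J i)))"
    using A by simp
  also have "\<dots> = (\<integral>\<^sup>+J. indicator A (a (J i)) \<partial>?M)"
    using A by (intro nn_integral_distr) (auto simp: measurable_point_measure_eq1)
  also have "\<dots> = (\<Sum>J\<in>?N. indicator A (a (J i)) * ennreal (T J))"
    by (simp add: nn_integral_point_measure_finite finite_multi_indices mult.commute)
  also have "\<dots> = (\<Sum>j\<in>{1..m i}. indicator A (a j) * (\<Sum>J\<in>{J\<in>?N. J i = j}. ennreal (T J)))"
    by (rule sum_multi_indices_by_coordinate[OF i])
  also have "\<dots> = (\<Sum>j\<in>{1..m i}. ennreal (p i j) * indicator A (a j))"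
  proof (intro sum.cong refl)
    fix j assume j: "j \<in> {1..m i}"
    have "(\<Sum>J\<in>{J\<in>?N. J i = j}. ennreal (T J)) = ennreal (\<Sum>J\<in>{J\<in>?N. J i = j}. T J)"
      using T by (intro sum_ennreal) (auto simp: feasible_tensors_def)
    then show "indicator A (a j) * (\<Sum>J\<in>{J\<in>?N. J i = j}. ennreal (T J)) = ennreal (p i j) * indicator A (a j)"
      using T i j by (simp add: feasible_tensors_def mult.commute)
  qed
  finally show "emeasure (distr ?M borel (\<lambda>J. a (J i))) A = emeasure (discrete_measure (m i) (p i) a) A"
    using A by (simp add: emeasure_discrete_measure)
qed simp

text \<open>For any map \<open>s\<close>, the law of \<open>s J\<close> under \<open>T\<close> is a
  finitely supported candidate \<open>?Q\<close>, and the joint law of \<open>s J\<close> and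
  \<open>a i (J i)\<close> couples it with the \<open>i\<close>-th measure. These couplings bound
  each \<open>W1\<close> term from above.\<close>

lemma barycenter_value_le_tensor:
  fixes a :: "nat \<Rightarrow> nat \<Rightarrow> real ^ 'd"
  assumes k: "1 \<le> k" and lam: "\<And>i. i \<in> {1..k} \<Longrightarrow> 0 \<le> lam i"
    and p: "(\<Sum>j\<in>{1..m 1}. p 1 j) = 1" and T: "T \<in> feasible_tensors k m p"
  shows "barycenter_value k lam (\<lambda>i. discrete_measure (m i) (p i) (a i)) \<le>
    ennreal (\<Sum>J\<in>multi_indices k m. weighted_cost k lam (\<lambda>i. a i (J i)) (s J) * T J)"
proof -
  let ?N = "multi_indices k m"
  let ?M = "point_measure ?N (\<lambda>J. ennreal (T J))"
  let ?Q = "distr ?M borel s"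
  have T0: "0 \<le> T J" if "J \<in> ?N" for J using T that by (auto simp: feasible_tensors_def)
  interpret M: prob_space ?M
  proof
    have "emeasure ?M ?N = ennreal (\<Sum>J\<in>?N. T J)"
      using T0 by (simp add: emeasure_point_measure_finite finite_multi_indices)
    then show "emeasure ?M (space ?M) = 1"
      using sum_feasible_tensor[OF T k p] by (simp add: space_point_measure)
  qed
  have int: "(\<integral>\<^sup>+J. f J \<partial>?M) = (\<Sum>J\<in>?N. ennreal (T J) * f J)" for f
    by (simp add: nn_integral_point_measure_finite finite_multi_indices)
  have "prob_space ?Q" by (intro M.prob_space_distr) (auto simp: measurable_point_measure_eq1)
  moreover have "(\<integral>\<^sup>+x. ennreal (l1norm x) \<partial>?Q) < \<infinity>"
  proof -
    have "(\<integral>\<^sup>+x. ennreal (l1norm x) \<partial>?Q) = (\<integral>\<^sup>+J. ennreal (l1norm (s J)) \<partial>?M)"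
      by (intro nn_integral_distr) (auto simp: measurable_point_measure_eq1)
    also have "\<dots> < \<infinity>"
      unfolding int by (simp add: finite_multi_indices ennreal_mult_less_top)
    finally show ?thesis .
  qed
  ultimately have Q: "?Q \<in> finite_moment_measures" by (simp add: finite_moment_measures_def)
  have W1: "W1 ?Q (discrete_measure (m i) (p i) (a i)) \<le>
      (\<Sum>J\<in>?N. ennreal (T J) * ennreal (l1norm (s J - a i (J i))))" if i: "i \<in> {1..k}" for i
  proof -
    let ?g = "\<lambda>J. (s J, a i (J i))"
    let ?C = "distr ?M (borel \<Otimes>\<^sub>M borel) ?g"
    have g: "?g \<in> measurable ?M (borel \<Otimes>\<^sub>M borel)"
      by (auto simp: measurable_point_measure_eq1 space_pair_measure)
    have "?C \<in> couplings ?Q (discrete_measure (m i) (p i) (a i))"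
      using distr_point_measure_eq_discrete_measure[OF T i, of "a i"] M.prob_space_distr[OF g]
      by (simp add: couplings_def distr_distr[OF _ g] o_def)
    then have "W1 ?Q (discrete_measure (m i) (p i) (a i)) \<le> (\<integral>\<^sup>+(x, y). ennreal (l1norm (x - y)) \<partial>?C)"
      unfolding W1_def by (rule INF_lower)
    also have "\<dots> = (\<integral>\<^sup>+J. ennreal (l1norm (s J - a i (J i))) \<partial>?M)"
      by (subst nn_integral_distr[OF g]) simp_all
    finally show ?thesis by (simp add: int)
  qed
  have "barycenter_value k lam (\<lambda>i. discrete_measure (m i) (p i) (a i)) \<le>
      (\<Sum>i\<in>{1..k}. ennreal (lam i) * W1 ?Q (discrete_measure (m i) (p i) (a i)))"
    unfolding barycenter_value_def by (rule INF_lower[OF Q])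
  also have "\<dots> \<le> (\<Sum>i\<in>{1..k}. ennreal (lam i) *
      (\<Sum>J\<in>?N. ennreal (T J) * ennreal (l1norm (s J - a i (J i)))))"
    by (intro sum_mono mult_left_mono W1) auto
  \<comment> \<open>Summing over \<open>i\<close> first collects the weighted distances of one tuple
    into its cost at \<open>s J\<close>.\<close>
  also have "\<dots> = (\<Sum>J\<in>?N. \<Sum>i\<in>{1..k}. ennreal (lam i) * ennreal (l1norm (s J - a i (J i))) * ennreal (T J))"
    unfolding sum_distrib_left by (subst sum.swap) (simp add: mult_ac)
  also have "\<dots> = (\<Sum>J\<in>?N. ennreal (weighted_cost k lam (\<lambda>i. a i (J i)) (s J) * T J))"
  proof (intro sum.cong refl)
    fix J assume J: "J \<in> ?N"
    have "ennreal (weighted_cost k lam (\<lambda>i. a i (J i)) (s J) * T J) =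
        ennreal (weighted_cost k lam (\<lambda>i. a i (J i)) (s J)) * ennreal (T J)"
      using T0[OF J] lam by (intro ennreal_mult weighted_cost_nonneg)
    then show "(\<Sum>i\<in>{1..k}. ennreal (lam i) * ennreal (l1norm (s J - a i (J i))) * ennreal (T J)) =
        ennreal (weighted_cost k lam (\<lambda>i. a i (J i)) (s J) * T J)"
      by (simp only: ennreal_weighted_cost[OF lam] sum_distrib_right)
  qed
  also have "\<dots> = ennreal (\<Sum>J\<in>?N. weighted_cost k lam (\<lambda>i. a i (J i)) (s J) * T J)"
    using T0 lam by (intro sum_ennreal mult_nonneg_nonneg weighted_cost_nonneg) auto
  finally show ?thesis .
qed

section \<open>From couplings to tensors\<close>

text \<open>The \<open>f j\<close> form the conditional law of the second coordinate given the first one.\<close>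

lemma coupling_disintegration:
  fixes a :: "nat \<Rightarrow> real ^ 'd"
  assumes inj: "inj_on a {1..m}" and w: "(\<Sum>j\<in>{1..m}. ennreal (w j)) = 1"
    and C: "C \<in> couplings Q (discrete_measure m w a)"
  obtains f where "\<And>j. f j \<in> borel_measurable borel" "\<And>y. (\<Sum>j\<in>{1..m}. f j y) = (1 :: ennreal)"
    "\<And>j. j \<in> {1..m} \<Longrightarrow> (\<integral>\<^sup>+y. f j y \<partial>Q) = ennreal (w j)"
    "(\<Sum>j\<in>{1..m}. \<integral>\<^sup>+y. ennreal (l1norm (y - a j)) * f j y \<partial>Q) \<le> (\<integral>\<^sup>+(x, y). ennreal (l1norm (x - y)) \<partial>C)"
proof -
  interpret C: prob_space C using C by (simp add: couplings_def)
  have sets_C [measurable_cong]: "sets C = sets (borel \<Otimes>\<^sub>M borel)" using C by (simp add: couplings_def)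
  have Q: "Q = distr C borel fst" and P: "discrete_measure m w a = distr C borel snd"
    using C by (auto simp: couplings_def)
  have sets_Q [measurable_cong, simp]: "sets Q = sets borel" by (simp add: Q)
  have fst_C [measurable]: "fst \<in> measurable C borel" and snd_C [measurable]: "snd \<in> measurable C borel"
    by measurable
  interpret Q: prob_space Q unfolding Q by (rule C.prob_space_distr) simp
  have int_Q: "(\<integral>\<^sup>+y. g y \<partial>Q) = (\<integral>\<^sup>+z. g (fst z) \<partial>C)" if "g \<in> borel_measurable borel" for g
    unfolding Q using that by (intro nn_integral_distr) auto
  have int_P: "emeasure (discrete_measure m w a) A = (\<integral>\<^sup>+z. indicator A (snd z) \<partial>C)"
    if A: "A \<in> sets borel" for A
  proof -
    have "(\<integral>\<^sup>+y. indicator A y \<partial>distr C borel snd) = (\<integral>\<^sup>+z. indicator A (snd z) \<partial>C)"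
      using A by (intro nn_integral_distr) auto
    then show ?thesis using A by (simp add: P)
  qed
  \<comment> \<open>\<open>\<nu> j\<close> is the part of \<open>C\<close> whose second coordinate
    is \<open>a j\<close>, projected to the first coordinate. It is bounded by \<open>Q\<close>,
    hence finite and absolutely continuous, and Radon-Nikodym gives the density
    \<open>f j\<close>.\<close>
  define \<nu> where "\<nu> j = distr (density C (\<lambda>z. indicator {a j} (snd z))) borel fst" for j
  have sets_\<nu> [measurable_cong, simp]: "sets (\<nu> j) = sets borel" for j by (simp add: \<nu>_def)
  have int_\<nu>: "(\<integral>\<^sup>+y. g y \<partial>\<nu> j) = (\<integral>\<^sup>+z. indicator {a j} (snd z) * g (fst z) \<partial>C)"
    if [measurable]: "g \<in> borel_measurable borel" for g j
    unfolding \<nu>_def by (subst nn_integral_distr) (simp_all add: nn_integral_density)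
  have em_\<nu>: "emeasure (\<nu> j) A = (\<integral>\<^sup>+z. indicator {a j} (snd z) * indicator A (fst z) \<partial>C)"
    if "A \<in> sets borel" for A j
    using that int_\<nu>[of "indicator A" j] by simp
  have "\<exists>f\<in>borel_measurable Q. density Q f = \<nu> j" for j
  proof (rule Q.Radon_Nikodym_finite_measure)
    have le: "emeasure (\<nu> j) A \<le> emeasure Q A" if A: "A \<in> sets borel" for A
    proof -
      have "emeasure (\<nu> j) A \<le> (\<integral>\<^sup>+z. indicator A (fst z) \<partial>C)"
        unfolding em_\<nu>[OF A] by (intro nn_integral_mono) (auto split: split_indicator)
      also have "\<dots> = emeasure Q A" using A int_Q[of "indicator A"] by simp
      finally show ?thesis .
    qed
    have "emeasure (\<nu> j) (space (\<nu> j)) \<noteq> \<infinity>"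
      using le[of UNIV] Q.emeasure_finite[of UNIV] by (auto simp: sets_eq_imp_space_eq[OF sets_\<nu>] top_unique)
    then show "finite_measure (\<nu> j)" by (rule finite_measureI)
    show "absolutely_continuous Q (\<nu> j)"
    proof (unfold absolutely_continuous_def, rule subsetI)
      fix A assume "A \<in> null_sets Q"
      then show "A \<in> null_sets (\<nu> j)" using le[of A] by (auto simp: null_sets_def)
    qed
  qed simp
  then obtain f where f_Q: "\<And>j. f j \<in> borel_measurable Q" and f: "\<And>j. density Q (f j) = \<nu> j"
    by metis
  have f_meas [measurable]: "f j \<in> borel_measurable borel" for j using f_Q[of j] by simp
  have int_f: "(\<integral>\<^sup>+y. g y * f j y \<partial>Q) = (\<integral>\<^sup>+z. indicator {a j} (snd z) * g (fst z) \<partial>C)"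
    if [measurable]: "g \<in> borel_measurable borel" for g j
    using int_\<nu>[OF that, of j] unfolding f[symmetric]
    by (simp add: nn_integral_density mult.commute)
  \<comment> \<open>Injectivity of \<open>a\<close> makes the singletons disjoint, so no point is
    counted twice.\<close>
  have ind: "(\<Sum>j\<in>{1..m}. indicator {a j} y) = (indicator (a ` {1..m}) y :: ennreal)" for y
  proof -
    have "indicator (\<Union>j\<in>{1..m}. {a j}) y = (\<Sum>j\<in>{1..m}. indicator {a j} y :: ennreal)"
      using inj by (intro indicator_UN_disjoint) (auto simp: disjoint_family_on_def dest: inj_onD)
    then show ?thesis by (simp add: UNION_singleton_eq_range)
  qed
  have fin: "finite (a ` {1..m})" by simp
  \<comment> \<open>The discrete measure has no mass off its atoms, so the second coordinate is
    almost surely an atom.\<close>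
  have "(\<integral>\<^sup>+z. indicator (- a ` {1..m}) (snd z) \<partial>C) = 0"
    using fin by (subst int_P[symmetric]) (auto simp: emeasure_discrete_measure finite_imp_closed)
  then have AE_atoms: "AE z in C. snd z \<in> a ` {1..m}"
    using fin by (subst (asm) nn_integral_0_iff_AE) (auto simp: indicator_eq_0_iff finite_imp_closed)
  \<comment> \<open>The measures \<open>\<nu> j\<close> add up to \<open>Q\<close>; uniqueness of
    densities then makes the \<open>f j\<close> add up to 1 almost everywhere.\<close>
  have "density Q (\<lambda>y. \<Sum>j\<in>{1..m}. f j y) = density Q (\<lambda>_. 1)"
  proof (rule measure_eqI)
    fix A assume "A \<in> sets (density Q (\<lambda>y. \<Sum>j\<in>{1..m}. f j y))"
    then have A [measurable]: "A \<in> sets borel" by simp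
    have "emeasure (density Q (\<lambda>y. \<Sum>j\<in>{1..m}. f j y)) A = (\<integral>\<^sup>+y. (\<Sum>j\<in>{1..m}. indicator A y * f j y) \<partial>Q)"
      by (subst emeasure_density) (auto simp: sum_distrib_left mult.commute)
    also have "\<dots> = (\<Sum>j\<in>{1..m}. \<integral>\<^sup>+z. indicator {a j} (snd z) * indicator A (fst z) \<partial>C)"
      by (subst nn_integral_sum) (auto simp: int_f)
    also have "\<dots> = (\<integral>\<^sup>+z. indicator (a ` {1..m}) (snd z) * indicator A (fst z) \<partial>C)"
      unfolding ind[symmetric] sum_distrib_right by (subst nn_integral_sum) auto
    also have "\<dots> = (\<integral>\<^sup>+z. indicator A (fst z) \<partial>C)"
      using AE_atoms by (intro nn_integral_cong_AE) auto
    also have "\<dots> = emeasure (density Q (\<lambda>_. 1)) A" using int_Q[of "indicator A"] by (simp add: density_1)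
    finally show "emeasure (density Q (\<lambda>y. \<Sum>j\<in>{1..m}. f j y)) A = emeasure (density Q (\<lambda>_. 1)) A" .
  qed simp
  then have AE_f: "AE y in Q. (\<Sum>j\<in>{1..m}. f j y) = 1"
    by (intro Q.density_unique) auto
  \<comment> \<open>On the null set where the densities fail to add up to 1 they are replaced by the
    weights \<open>w\<close>, which do. Integrals against \<open>Q\<close> stay the same and the sum
    is 1 at every \<open>y\<close>.\<close>
  define h where "h j y = (if (\<Sum>j\<in>{1..m}. f j y) = 1 then f j y else ennreal (w j))" for j y
  have h_f: "(\<integral>\<^sup>+y. g y * h j y \<partial>Q) = (\<integral>\<^sup>+z. indicator {a j} (snd z) * g (fst z) \<partial>C)"
    if "g \<in> borel_measurable borel" for g j
    unfolding int_f[OF that, symmetric]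
    by (rule nn_integral_cong_AE) (use AE_f in \<open>auto simp: h_def\<close>)
  show thesis
  proof (rule that)
    show "h j \<in> borel_measurable borel" for j unfolding h_def by measurable
    show "(\<Sum>j\<in>{1..m}. h j y) = 1" for y
      using w unfolding h_def by (cases "(\<Sum>j\<in>{1..m}. f j y) = 1") (simp_all only: if_True if_False simp_thms)
    show "(\<integral>\<^sup>+y. h j y \<partial>Q) = ennreal (w j)" if j: "j \<in> {1..m}" for j
    proof -
      have "(\<integral>\<^sup>+y. h j y \<partial>Q) = emeasure (discrete_measure m w a) {a j}"
        using h_f[of "\<lambda>_. 1" j] int_P[of "{a j}"] by simp
      \<comment> \<open>By injectivity no other atom contributes to the mass at
        \<open>a j\<close>.\<close>
      also have "\<dots> = (\<Sum>j'\<in>{1..m}. if j' = j then ennreal (w j') else 0)"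
        unfolding emeasure_discrete_measure[OF borel_singleton[OF sets.empty_sets]]
        using inj j by (intro sum.cong) (auto simp: indicator_def dest: inj_onD)
      finally show ?thesis using j by simp
    qed
    have "(\<Sum>j\<in>{1..m}. \<integral>\<^sup>+y. ennreal (l1norm (y - a j)) * h j y \<partial>Q) =
        (\<Sum>j\<in>{1..m}. \<integral>\<^sup>+z. indicator {a j} (snd z) * ennreal (l1norm (fst z - a j)) \<partial>C)"
      by (intro sum.cong refl h_f) measurable
    also have "\<dots> = (\<integral>\<^sup>+z. (\<Sum>j\<in>{1..m}. indicator {a j} (snd z) * ennreal (l1norm (fst z - a j))) \<partial>C)"
      by (subst nn_integral_sum) auto
    also have "\<dots> = (\<integral>\<^sup>+z. (\<Sum>j\<in>{1..m}. indicator {a j} (snd z) * ennreal (l1norm (fst z - snd z))) \<partial>C)"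
      by (intro nn_integral_cong sum.cong) (auto split: split_indicator)
    \<comment> \<open>An inequality suffices here: the indicators of the distinct atoms add up to at
      most 1.\<close>
    also have "\<dots> \<le> (\<integral>\<^sup>+z. ennreal (l1norm (fst z - snd z)) \<partial>C)"
      unfolding sum_distrib_right[symmetric] ind
      by (intro nn_integral_mono) (auto split: split_indicator)
    finally show "(\<Sum>j\<in>{1..m}. \<integral>\<^sup>+y. ennreal (l1norm (y - a j)) * h j y \<partial>Q) \<le>
        (\<integral>\<^sup>+(x, y). ennreal (l1norm (x - y)) \<partial>C)"
      by (simp add: case_prod_unfold)
  qed
qed

text \<open>Disintegrates a coupling whose cost is within \<open>e\<close> of the infimum defining
  \<open>W1\<close>; the slack avoids having to prove that an optimal coupling exists.\<close>

lemma near_optimal_kernel: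
  fixes a :: "nat \<Rightarrow> real ^ 'd" and e :: real
  assumes inj: "inj_on a {1..m}" and w0: "\<And>j. j \<in> {1..m} \<Longrightarrow> 0 \<le> w j" and w: "(\<Sum>j\<in>{1..m}. w j) = 1"
    and Q: "prob_space Q" and e: "0 < e"
  obtains f where "\<And>j. f j \<in> borel_measurable borel" "\<And>y. (\<Sum>j\<in>{1..m}. f j y) = (1 :: ennreal)"
    "\<And>j. j \<in> {1..m} \<Longrightarrow> (\<integral>\<^sup>+y. f j y \<partial>Q) = ennreal (w j)"
    "(\<Sum>j\<in>{1..m}. \<integral>\<^sup>+y. ennreal (l1norm (y - a j)) * f j y \<partial>Q) \<le>
      W1 Q (discrete_measure m w a) + ennreal e"
proof (cases "W1 Q (discrete_measure m w a) = \<top>")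
  case True
  have "(\<Sum>j\<in>{1..m}. ennreal (w j)) = 1" using w0 w by (subst sum_ennreal) auto
  \<comment> \<open>The cost bound is trivial, so the kernel that draws from \<open>w\<close>
    independently of \<open>y\<close> will do; its integrals are right because \<open>Q\<close> has
    mass 1.\<close>
  then show thesis using True prob_space.emeasure_space_1[OF Q] by (intro that[of "\<lambda>j _. ennreal (w j)"]) auto
next
  case False
  have w': "(\<Sum>j\<in>{1..m}. ennreal (w j)) = 1" using w0 w by (subst sum_ennreal) auto
  \<comment> \<open>A finite infimum lies strictly below itself plus \<open>e\<close>, so some
    coupling costs less than this sum.\<close>
  have "W1 Q (discrete_measure m w a) < W1 Q (discrete_measure m w a) + ennreal e"
    using False e by (cases "W1 Q (discrete_measure m w a)")
      (auto simp: ennreal_plus[symmetric] ennreal_less_iff simp del: ennreal_plus)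
  then obtain C where C: "C \<in> couplings Q (discrete_measure m w a)"
    and le: "(\<integral>\<^sup>+(x, y). ennreal (l1norm (x - y)) \<partial>C) < W1 Q (discrete_measure m w a) + ennreal e"
    unfolding W1_def INF_less_iff by blast
  show thesis
    by (rule coupling_disintegration[OF inj w' C]) (rule that; use le in \<open>auto intro: order_trans less_imp_le\<close>)
qed

text \<open>Gluing: given the point \<open>y\<close> of the barycenter, draw the \<open>k\<close> atoms independently.\<close>

lemma glued_tensor:
  fixes f :: "nat \<Rightarrow> nat \<Rightarrow> real ^ 'd \<Rightarrow> ennreal" and c :: "nat \<Rightarrow> nat \<Rightarrow> real ^ 'd \<Rightarrow> ennreal"
  assumes Q: "prob_space Q" "sets Q = sets borel"
    and f: "\<And>i j. i \<in> {1..k} \<Longrightarrow> f i j \<in> borel_measurable borel"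
    and f_sum: "\<And>i y. i \<in> {1..k} \<Longrightarrow> (\<Sum>j\<in>{1..m i}. f i j y) = 1"
    and f_int: "\<And>i j. i \<in> {1..k} \<Longrightarrow> j \<in> {1..m i} \<Longrightarrow> (\<integral>\<^sup>+y. f i j y \<partial>Q) = ennreal (p i j)"
    and p: "\<And>i j. i \<in> {1..k} \<Longrightarrow> j \<in> {1..m i} \<Longrightarrow> 0 \<le> p i j"
    and c: "\<And>i j. i \<in> {1..k} \<Longrightarrow> j \<in> {1..m i} \<Longrightarrow> c i j \<in> borel_measurable borel"
    and D: "\<And>J y. J \<in> multi_indices k m \<Longrightarrow> D J \<le> (\<Sum>i\<in>{1..k}. c i (J i) y)"
  obtains T where "T \<in> feasible_tensors k m p"
    "(\<Sum>J\<in>multi_indices k m. D J * ennreal (T J)) \<le> (\<Sum>i\<in>{1..k}. \<Sum>j\<in>{1..m i}. \<integral>\<^sup>+y. c i j y * f i j y \<partial>Q)"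
proof -
  let ?N = "multi_indices k m"
  interpret prob_space Q by fact
  note Q(2)[measurable_cong]
  \<comment> \<open>\<open>F J y\<close> is the conditional probability of the tuple
    \<open>J\<close> given \<open>y\<close>, under independent draws.\<close>
  define F where "F J y = (\<Prod>i\<in>{1..k}. f i (J i) y)" for J y
  have [measurable]: "F J \<in> borel_measurable borel" for J
    unfolding F_def using f by (intro borel_measurable_prod_ennreal)
  have F_marginal: "(\<Sum>J\<in>{J\<in>?N. J i = j}. F J y) = f i j y" if "i \<in> {1..k}" "j \<in> {1..m i}" for i j y
    unfolding F_def using that f_sum by (intro sum_multi_indices_prod_marginal)
  have f_le: "f i j y \<le> 1" if "i \<in> {1..k}" "j \<in> {1..m i}" for i j y
    unfolding f_sum[OF that(1), of y, symmetric] using that by (intro member_le_sum) auto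
  \<comment> \<open>Averaging over \<open>y\<close> gives the tensor. The conversion to reals loses
    nothing on \<open>?N\<close>, since \<open>F J\<close> is at most 1 there and \<open>Q\<close>
    is a probability measure.\<close>
  define T where "T J = enn2real (\<integral>\<^sup>+y. F J y \<partial>Q)" for J
  have T: "ennreal (T J) = (\<integral>\<^sup>+y. F J y \<partial>Q)" if J: "J \<in> ?N" for J
  proof -
    have "(\<integral>\<^sup>+y. F J y \<partial>Q) \<le> (\<integral>\<^sup>+y. 1 \<partial>Q)"
      unfolding F_def using f_le multi_indices_nth[OF J]
      by (intro nn_integral_mono prod_le_1) auto
    then have "(\<integral>\<^sup>+y. F J y \<partial>Q) < \<top>" by (simp add: emeasure_space_1 le_less_trans)
    then show ?thesis by (simp add: T_def)
  qed
  have "T \<in> feasible_tensors k m p"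
    unfolding feasible_tensors_def
  proof (intro CollectI conjI ballI)
    fix i j assume i: "i \<in> {1..k}" and j: "j \<in> {1..m i}"
    have "ennreal (\<Sum>J\<in>{J\<in>?N. J i = j}. T J) = (\<Sum>J\<in>{J\<in>?N. J i = j}. ennreal (T J))"
      by (rule sum_ennreal[symmetric]) (simp add: T_def)
    also have "\<dots> = (\<Sum>J\<in>{J\<in>?N. J i = j}. \<integral>\<^sup>+y. F J y \<partial>Q)"
      using T by (intro sum.cong) auto
    also have "\<dots> = (\<integral>\<^sup>+y. (\<Sum>J\<in>{J\<in>?N. J i = j}. F J y) \<partial>Q)"
      by (rule nn_integral_sum[symmetric]) measurable
    also have "\<dots> = ennreal (p i j)" using F_marginal[OF i j] f_int[OF i j] by simp
    finally show "(\<Sum>J\<in>{J\<in>?N. J i = j}. T J) = p i j"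
      using p[OF i j] by (simp add: sum_nonneg T_def)
  qed (simp add: T_def)
  moreover have "(\<Sum>J\<in>?N. D J * ennreal (T J)) \<le> (\<Sum>i\<in>{1..k}. \<Sum>j\<in>{1..m i}. \<integral>\<^sup>+y. c i j y * f i j y \<partial>Q)"
  proof -
    have "(\<Sum>J\<in>?N. D J * ennreal (T J)) = (\<Sum>J\<in>?N. \<integral>\<^sup>+y. D J * F J y \<partial>Q)"
      using T by (intro sum.cong refl) (simp add: nn_integral_cmult)
    also have "\<dots> = (\<integral>\<^sup>+y. (\<Sum>J\<in>?N. D J * F J y) \<partial>Q)"
      by (rule nn_integral_sum[symmetric]) measurable
    also have "\<dots> \<le> (\<integral>\<^sup>+y. (\<Sum>i\<in>{1..k}. \<Sum>j\<in>{1..m i}. c i j y * f i j y) \<partial>Q)"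
    proof (rule nn_integral_mono)
      fix y
      \<comment> \<open>The bound on \<open>D J\<close> holds at every \<open>y\<close>, so it may
        be used under the integral. Each \<open>c i\<close> reads only \<open>J i\<close>, so
        summing out the other entries turns \<open>F J y\<close> into
        \<open>f i j y\<close>.\<close>
      have "(\<Sum>J\<in>?N. D J * F J y) \<le> (\<Sum>J\<in>?N. (\<Sum>i\<in>{1..k}. c i (J i) y) * F J y)"
        using D by (intro sum_mono mult_right_mono) auto
      also have "\<dots> = (\<Sum>i\<in>{1..k}. \<Sum>J\<in>?N. c i (J i) y * F J y)"
        unfolding sum_distrib_right by (rule sum.swap)
      also have "\<dots> = (\<Sum>i\<in>{1..k}. \<Sum>j\<in>{1..m i}. c i j y * f i j y)"
      proof (intro sum.cong refl)
        fix i assume i: "i \<in> {1..k}"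
        show "(\<Sum>J\<in>?N. c i (J i) y * F J y) = (\<Sum>j\<in>{1..m i}. c i j y * f i j y)"
          unfolding sum_multi_indices_by_coordinate[OF i, of "\<lambda>j. c i j y"]
          using F_marginal[OF i] by (intro sum.cong) auto
      qed
      finally show "(\<Sum>J\<in>?N. D J * F J y) \<le> (\<Sum>i\<in>{1..k}. \<Sum>j\<in>{1..m i}. c i j y * f i j y)" .
    qed
    also have "\<dots> = (\<Sum>i\<in>{1..k}. \<integral>\<^sup>+y. (\<Sum>j\<in>{1..m i}. c i j y * f i j y) \<partial>Q)"
      using f c by (intro nn_integral_sum) (auto simp: measurable_cong_sets[OF Q(2) refl])
    also have "\<dots> = (\<Sum>i\<in>{1..k}. \<Sum>j\<in>{1..m i}. \<integral>\<^sup>+y. c i j y * f i j y \<partial>Q)"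
      using f c by (intro sum.cong refl nn_integral_sum) (auto simp: measurable_cong_sets[OF Q(2) refl])
    finally show ?thesis .
  qed
  ultimately show thesis by (rule that)
qed

text \<open>Combines the near optimal kernels of the \<open>k\<close> measures by gluing.
  \<open>D\<close> stands for any nonnegative lower bound on the tuple cost over the whole space,
  since \<open>Q\<close> may charge points outside every finite set.\<close>

lemma tensor_below_transport_cost:
  fixes a :: "nat \<Rightarrow> nat \<Rightarrow> real ^ 'd" and e :: real
  assumes lam: "\<And>i. i \<in> {1..k} \<Longrightarrow> 0 \<le> lam i" and lam_sum: "(\<Sum>i\<in>{1..k}. lam i) = 1"
    and p: "\<And>i j. i \<in> {1..k} \<Longrightarrow> j \<in> {1..m i} \<Longrightarrow> 0 \<le> p i j"
    and p_sum: "\<And>i. i \<in> {1..k} \<Longrightarrow> (\<Sum>j\<in>{1..m i}. p i j) = 1"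
    and inj: "\<And>i. i \<in> {1..k} \<Longrightarrow> inj_on (a i) {1..m i}"
    and Q: "Q \<in> finite_moment_measures" and e: "0 < e"
    and D0: "\<And>J. J \<in> multi_indices k m \<Longrightarrow> 0 \<le> D J"
    and D: "\<And>J y. J \<in> multi_indices k m \<Longrightarrow> D J \<le> weighted_cost k lam (\<lambda>i. a i (J i)) y"
  obtains T where "T \<in> feasible_tensors k m p"
    "ennreal (\<Sum>J\<in>multi_indices k m. D J * T J) \<le>
      (\<Sum>i\<in>{1..k}. ennreal (lam i) * W1 Q (discrete_measure (m i) (p i) (a i))) + ennreal e"
proof -
  let ?W = "\<lambda>i. W1 Q (discrete_measure (m i) (p i) (a i))"
  have pr: "prob_space Q" and sets_Q: "sets Q = sets borel" using Q by (auto simp: finite_moment_measures_def)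
  \<comment> \<open>The four properties are bundled into one predicate so that a single choice
    yields a kernel for every \<open>i\<close>.\<close>
  define kernel where "kernel i f \<longleftrightarrow>
      (\<forall>j. f j \<in> borel_measurable borel) \<and> (\<forall>y. (\<Sum>j\<in>{1..m i}. f j y) = (1 :: ennreal)) \<and>
      (\<forall>j\<in>{1..m i}. (\<integral>\<^sup>+y. f j y \<partial>Q) = ennreal (p i j)) \<and>
      (\<Sum>j\<in>{1..m i}. \<integral>\<^sup>+y. ennreal (l1norm (y - a i j)) * f j y \<partial>Q) \<le> ?W i + ennreal e" for i f
  have "\<forall>i\<in>{1..k}. \<exists>f. kernel i f"
  proof
    fix i assume i: "i \<in> {1..k}"
    show "\<exists>f. kernel i f"
      unfolding kernel_def
      by (rule near_optimal_kernel[OF inj[OF i] p[OF i] p_sum[OF i] pr e]) (assumption, blast)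
  qed
  from bchoice[OF this] obtain f where kernel: "\<And>i. i \<in> {1..k} \<Longrightarrow> kernel i (f i)" by blast
  have f: "\<And>i j. i \<in> {1..k} \<Longrightarrow> f i j \<in> borel_measurable borel"
    "\<And>i y. i \<in> {1..k} \<Longrightarrow> (\<Sum>j\<in>{1..m i}. f i j y) = 1"
    "\<And>i j. i \<in> {1..k} \<Longrightarrow> j \<in> {1..m i} \<Longrightarrow> (\<integral>\<^sup>+y. f i j y \<partial>Q) = ennreal (p i j)"
    "\<And>i. i \<in> {1..k} \<Longrightarrow>
      (\<Sum>j\<in>{1..m i}. \<integral>\<^sup>+y. ennreal (l1norm (y - a i j)) * f i j y \<partial>Q) \<le> ?W i + ennreal e"
    using kernel unfolding kernel_def by blast+
  have [measurable]: "(\<lambda>y. ennreal (l1norm (y - a i j))) \<in> borel_measurable borel" for i j by measurable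
  have D': "ennreal (D J) \<le> (\<Sum>i\<in>{1..k}. ennreal (lam i) * ennreal (l1norm (y - a i (J i))))"
    if "J \<in> multi_indices k m" for J y
    using ennreal_leI[OF D[OF that, of y]] by (simp only: ennreal_weighted_cost[OF lam])
  \<comment> \<open>The gluing is applied with \<open>c i j y\<close> equal to \<open>lam i\<close>
    times the distance from \<open>y\<close> to \<open>a i j\<close>.\<close>
  obtain T where T: "T \<in> feasible_tensors k m p"
    and le: "(\<Sum>J\<in>multi_indices k m. ennreal (D J) * ennreal (T J)) \<le> (\<Sum>i\<in>{1..k}. \<Sum>j\<in>{1..m i}.
      \<integral>\<^sup>+y. ennreal (lam i) * ennreal (l1norm (y - a i j)) * f i j y \<partial>Q)"
    by (rule glued_tensor[OF pr sets_Q f(1-3) p _ D']) measurable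
  have "ennreal (\<Sum>J\<in>multi_indices k m. D J * T J) = (\<Sum>J\<in>multi_indices k m. ennreal (D J * T J))"
    using D0 T by (intro sum_ennreal[symmetric] mult_nonneg_nonneg) (auto simp: feasible_tensors_def)
  also have "\<dots> = (\<Sum>J\<in>multi_indices k m. ennreal (D J) * ennreal (T J))"
    using D0 T by (intro sum.cong refl ennreal_mult) (auto simp: feasible_tensors_def)
  also note le
  also have "(\<Sum>i\<in>{1..k}. \<Sum>j\<in>{1..m i}.
      \<integral>\<^sup>+y. ennreal (lam i) * ennreal (l1norm (y - a i j)) * f i j y \<partial>Q) =
      (\<Sum>i\<in>{1..k}. ennreal (lam i) *
        (\<Sum>j\<in>{1..m i}. \<integral>\<^sup>+y. ennreal (l1norm (y - a i j)) * f i j y \<partial>Q))"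
    unfolding sum_distrib_left mult.assoc using f(1)
    by (intro sum.cong refl nn_integral_cmult) (auto simp: measurable_cong_sets[OF sets_Q refl])
  also have "\<dots> \<le> (\<Sum>i\<in>{1..k}. ennreal (lam i) * (?W i + ennreal e))"
    by (intro sum_mono mult_left_mono f(4)) auto
  \<comment> \<open>Each measure brings slack \<open>e\<close>, but the weights sum to 1, so the
    total slack is again \<open>e\<close>.\<close>
  also have "\<dots> = (\<Sum>i\<in>{1..k}. ennreal (lam i) * ?W i) + (\<Sum>i\<in>{1..k}. ennreal (lam i)) * ennreal e"
    by (simp add: distrib_left sum.distrib sum_distrib_right)
  also have "(\<Sum>i\<in>{1..k}. ennreal (lam i)) = 1" using lam lam_sum by (subst sum_ennreal) auto
  finally show thesis using T that by simp
qed

section \<open>The coordinate grid preserves the barycenter value\<close>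

theorem mainTheorem10:
  fixes k n :: nat
    and lam :: "nat \<Rightarrow> real"
    and Xi :: "nat \<Rightarrow> (real ^ 'd) set"
    and xhat :: "nat \<Rightarrow> nat \<Rightarrow> real ^ 'd"
    and phat :: "nat \<Rightarrow> nat \<Rightarrow> real"
  assumes Xi: "\<And>i. i \<in> {1..k} \<Longrightarrow> finite (Xi i) \<and> Xi i \<noteq> {} \<and> card (Xi i) \<le> n"
    and xhat: "\<And>i. i \<in> {1..k} \<Longrightarrow> bij_betw (xhat i) {1..card (Xi i)} (Xi i)"
    and phat_nonneg: "\<And>i j. i \<in> {1..k} \<Longrightarrow> j \<in> {1..card (Xi i)} \<Longrightarrow> 0 \<le> phat i j"
    and phat_sum: "\<And>i. i \<in> {1..k} \<Longrightarrow> (\<Sum>j\<in>{1..card (Xi i)}. phat i j) = 1"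
    and lam_nonneg: "\<And>i. i \<in> {1..k} \<Longrightarrow> 0 \<le> lam i"
    and lam_sum: "(\<Sum>i\<in>{1..k}. lam i) = 1"
  shows "(\<forall>x. (\<forall>i\<in>{1..k}. x i \<in> Xi i) \<longrightarrow>
            (\<exists>v. is_minimum v (weighted_cost k lam x ` coord_grid k Xi) \<and>
                 is_minimum v (range (weighted_cost k lam x)))) \<and>
         is_minimum (mmot_value k lam (\<lambda>i. card (Xi i)) phat xhat (coord_grid k Xi))
           (mmot_values k lam (\<lambda>i. card (Xi i)) phat xhat (coord_grid k Xi)) \<and>
         ennreal (mmot_value k lam (\<lambda>i. card (Xi i)) phat xhat (coord_grid k Xi)) =
           barycenter_value k lam (\<lambda>i. discrete_measure (card (Xi i)) (phat i) (xhat i)) \<and>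
         finite (coord_grid k Xi) \<and>
         card (coord_grid k Xi) \<le> (\<Sum>i\<in>{1..k}. card (Xi i)) ^ CARD('d) \<and>
         (\<Sum>i\<in>{1..k}. card (Xi i)) ^ CARD('d) \<le> (n * k) ^ CARD('d)"
proof -
  let ?G = "coord_grid k Xi" and ?m = "\<lambda>i. card (Xi i)"
  let ?N = "multi_indices k ?m"
  let ?v = "mmot_value k lam ?m phat xhat ?G"
  let ?D = "mmot_cost k lam xhat ?G"
  have fin_Xi: "finite (Xi i)" if "i \<in> {1..k}" for i using Xi[OF that] by blast
  \<comment> \<open>For \<open>k = 0\<close> the weights would have the empty sum 0 instead of
    1.\<close>
  have k: "1 \<le> k" using lam_sum by (cases k) auto
  note grid = card_coord_grid_le[of k Xi, OF fin_Xi]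
  note cost_nonneg = weighted_cost_nonneg[of k lam, OF lam_nonneg]
  have grid_min: "Min (weighted_cost k lam x ` ?G) \<in> weighted_cost k lam x ` ?G \<and>
      (\<forall>t. Min (weighted_cost k lam x ` ?G) \<le> weighted_cost k lam x t)"
    if x: "\<And>i. i \<in> {1..k} \<Longrightarrow> x i \<in> Xi i" for x
  proof
    have attained: "\<exists>s\<in>?G. weighted_cost k lam x s \<le> weighted_cost k lam x t" for t
      using weighted_cost_attained_on_coord_grid[of k Xi x lam t, OF k fin_Xi x lam_nonneg] .
    then show "Min (weighted_cost k lam x ` ?G) \<in> weighted_cost k lam x ` ?G"
      using grid(1) by (intro Min_in) auto
    show "\<forall>t. Min (weighted_cost k lam x ` ?G) \<le> weighted_cost k lam x t"
      using attained grid(1) by (meson Min_le finite_imageI imageI order_trans)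
  qed
  have atoms: "xhat i (J i) \<in> Xi i" if "J \<in> ?N" "i \<in> {1..k}" for J i
    using bij_betwE[OF xhat[OF that(2)]] multi_indices_nth[OF that] by blast
  \<comment> \<open>The first fact, attainment, serves the upper bound on the barycenter value; the
    second, a bound over the whole space, serves the lower bound.\<close>
  have D: "?D J \<in> weighted_cost k lam (\<lambda>i. xhat i (J i)) ` ?G"
    "\<And>y. ?D J \<le> weighted_cost k lam (\<lambda>i. xhat i (J i)) y" if "J \<in> ?N" for J
    unfolding mmot_cost_def using grid_min[of "\<lambda>i. xhat i (J i)"] atoms[OF that] by blast+
  have D0: "0 \<le> ?D J" if "J \<in> ?N" for J using D(1)[OF that] cost_nonneg by auto
  have min: "is_minimum ?v (mmot_values k lam ?m phat xhat ?G)"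
    using mmot_value_attained[of k ?m phat lam xhat ?G, OF k phat_nonneg phat_sum] .
  have v_le: "?v \<le> (\<Sum>J\<in>?N. ?D J * T J)" if "T \<in> feasible_tensors k ?m phat" for T
    using min that by (auto simp: is_minimum_def mmot_values_def)
  have "ennreal ?v = barycenter_value k lam (\<lambda>i. discrete_measure (?m i) (phat i) (xhat i))"
  proof (rule antisym)
    show "ennreal ?v \<le> barycenter_value k lam (\<lambda>i. discrete_measure (?m i) (phat i) (xhat i))"
      unfolding barycenter_value_def
    proof (rule INF_greatest, rule ennreal_le_epsilon)
      fix Q :: "(real ^ 'd) measure" and e :: real
      assume Q: "Q \<in> finite_moment_measures" and e: "0 < e"
      obtain T where T: "T \<in> feasible_tensors k ?m phat" and le: "ennreal (\<Sum>J\<in>?N. ?D J * T J) \<le>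
          (\<Sum>i\<in>{1..k}. ennreal (lam i) * W1 Q (discrete_measure (?m i) (phat i) (xhat i))) + ennreal e"
        using tensor_below_transport_cost[of k lam ?m phat xhat Q e ?D, OF lam_nonneg lam_sum
            phat_nonneg phat_sum bij_betw_imp_inj_on[OF xhat] Q e D0 D(2)] .
      show "ennreal ?v \<le>
          (\<Sum>i\<in>{1..k}. ennreal (lam i) * W1 Q (discrete_measure (?m i) (phat i) (xhat i))) + ennreal e"
        using ennreal_leI[OF v_le[OF T]] le by (rule order_trans)
    qed
    obtain T where T: "T \<in> feasible_tensors k ?m phat" and v: "?v = (\<Sum>J\<in>?N. ?D J * T J)"
      using min by (auto simp: is_minimum_def mmot_values_def)
    \<comment> \<open>\<open>s\<close> sends each tuple to a point attaining its cost; pushing the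
      optimal tensor forward along \<open>s\<close> gives a barycenter candidate of cost at most
      \<open>?v\<close>.\<close>
    have "\<forall>J\<in>?N. \<exists>s. ?D J = weighted_cost k lam (\<lambda>i. xhat i (J i)) s" using D(1) by blast
    from bchoice[OF this] obtain s where s: "\<And>J. J \<in> ?N \<Longrightarrow> ?D J = weighted_cost k lam (\<lambda>i. xhat i (J i)) (s J)"
      by blast
    have "?v = (\<Sum>J\<in>?N. weighted_cost k lam (\<lambda>i. xhat i (J i)) (s J) * T J)"
      unfolding v using s by (intro sum.cong) auto
    then show "barycenter_value k lam (\<lambda>i. discrete_measure (?m i) (phat i) (xhat i)) \<le> ennreal ?v"
      using barycenter_value_le_tensor[where k = k and lam = lam and m = ?m and a = xhat and s = s, OF k lam_nonneg _ T] phat_sum[of 1] k by simp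
  qed
  moreover have "\<forall>x. (\<forall>i\<in>{1..k}. x i \<in> Xi i) \<longrightarrow>
      (\<exists>v. is_minimum v (weighted_cost k lam x ` ?G) \<and> is_minimum v (range (weighted_cost k lam x)))"
  proof (intro allI impI)
    fix x :: "nat \<Rightarrow> real ^ 'd" assume "\<forall>i\<in>{1..k}. x i \<in> Xi i"
    then show "\<exists>v. is_minimum v (weighted_cost k lam x ` ?G) \<and> is_minimum v (range (weighted_cost k lam x))"
      using grid_min[of x] unfolding is_minimum_def
      by (intro exI[of _ "Min (weighted_cost k lam x ` ?G)"]) blast
  qed
  moreover have "(\<Sum>i\<in>{1..k}. card (Xi i)) ^ CARD('d) \<le> (n * k) ^ CARD('d)"
    using sum_bounded_above[of "{1..k}" ?m n] Xi by (intro power_mono) (auto simp: mult.commute)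
  ultimately show ?thesis using min grid by blast
qed

end
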